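(* Let $L$ be a number field with Galois closure $\widehat{L}$, and suppose that $\operatorname{Gal}(\widehat{L}/\mathbb{Q})$ is of generalized $S_3$-type. Then $L\subseteq \widehat{L}\subseteq \mathbb{Q}(3^\infty)$.
   Context: Fix an algebraic closure $\overline{\mathbb{Q}}$ containing all fields considered. $\mathbb{Q}(3^\infty)$ is the compositum in $\overline{\mathbb{Q}}$ of all number fields of degree $3$ over $\mathbb{Q}$. A finite group is of generalized $S_3$-type if it is isomorphic to a subgroup of a finite direct product $S_3\times\cdots\times S_3$. *)

theory Defs
  imports
    "HOL-Algebra.Algebraic_Closure_Type"
    "HOL-Algebra.Generated_Fields"
    "HOL-Algebra.Bij"
    "HOL-Algebra.Product_Groups"
    "HOL-Algebra.Sym_Groups"
begin

text \<open>The field of algebraic numbers is a type \<^typ>\<open>'a\<close> of sort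
  \<open>{alg_closed_field, field_char_0}\<close>; all of its elements are required to be algebraic
  in the theorem. Number fields are subsets of \<^typ>\<open>'a\<close>, and the HOL-Algebra notions apply to
  them through the record of the field operations of \<^typ>\<open>'a\<close>.\<close>

abbreviation ambient :: "'a::field_char_0 ring" where
  "ambient \<equiv> ring_of_type_algebra"

definition number_field :: "'a::field_char_0 set \<Rightarrow> bool" where
  "number_field K \<longleftrightarrow> subfield K ambient \<and> ring.finite_dimension ambient \<rat> K"

definition number_field_of_degree :: "nat \<Rightarrow> 'a::field_char_0 set \<Rightarrow> bool" where
  "number_field_of_degree n K \<longleftrightarrow> subfield K ambient \<and> ring.dimension ambient n \<rat> K"

text \<open>Galois extensions of the rationals inside an algebraic closure. Every extension is separable in
  characteristic 0, so the condition is normality. As \<^typ>\<open>'a\<close> is algebraically closed, a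
  polynomial splits over \<open>M\<close> iff all its roots in \<^typ>\<open>'a\<close> lie in \<open>M\<close>. There is no finiteness
  requirement.\<close>

definition galois_over_rats :: "'a::{alg_closed_field, field_char_0} set \<Rightarrow> bool" where
  "galois_over_rats M \<longleftrightarrow> subfield M ambient \<and>
     (\<forall>p :: rat poly. Factorial_Ring.irreducible p \<longrightarrow>
        (\<exists>x\<in>M. poly (map_poly of_rat p) x = 0) \<longrightarrow>
        (\<forall>y. poly (map_poly of_rat p) y = 0 \<longrightarrow> y \<in> M))"

definition galois_closure :: "'a::{alg_closed_field, field_char_0} set \<Rightarrow> 'a set" where
  "galois_closure L = galois_over_rats hull L"

text \<open>The automorphisms of \<open>M\<close> fixing \<open>K\<close> pointwise, as functions that are
  \<^const>\<open>undefined\<close> outside \<open>M\<close>, under composition.\<close>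

definition galois_group :: "'a::field_char_0 set \<Rightarrow> 'a set \<Rightarrow> ('a \<Rightarrow> 'a) monoid" where
  "galois_group K M = (BijGroup M)
     \<lparr>carrier := {\<sigma> \<in> Bij M.
        \<sigma> \<in> ring_hom (ambient\<lparr>carrier := M\<rparr>) (ambient\<lparr>carrier := M\<rparr>) \<and> (\<forall>x\<in>K. \<sigma> x = x)}\<rparr>"

definition generalized_S3_type :: "('g, 'm) monoid_scheme \<Rightarrow> bool" where
  "generalized_S3_type G \<longleftrightarrow> group G \<and> finite (carrier G) \<and>
     (\<exists>(n::nat) H. let P = product_group {..<n} (\<lambda>_. sym_group 3)
        in subgroup H P \<and> G \<cong> P\<lparr>carrier := H\<rparr>)"

definition compositum_of_cubic_fields :: "'a::field_char_0 set" where
  "compositum_of_cubic_fields = generate_field ambient (\<Union>{K. number_field_of_degree 3 K})"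

end

theory Submission
  imports Defs
begin

text \<open>Let \<open>M\<close> be the Galois closure, \<open>G\<close> its Galois group and \<open>C\<close> the compositum of the cubic fields.
  Every \<open>\<sigma> \<noteq> 1\<close> in \<open>G\<close> acts nontrivially on three points through one of the projections
  \<open>\<pi> : G \<rightarrow> S\<^sub>3\<close>. For \<open>z \<in> M\<close> the sums of \<open>\<tau> z\<close> over the cosets \<open>{\<tau>. \<pi> \<tau> j = k}\<close> are permuted by
  \<open>G\<close> like the three points, hence are roots of a rational cubic, and independence of characters
  provides \<open>z\<close> for which \<open>\<sigma>\<close> moves one of them, \<open>y\<^sub>\<sigma>\<close>. Roots of rational cubics lie in \<open>C\<close>: irreducible
  cubics by definition, and quadratic irrationalities because every square root of a rational is
  the square root of the discriminant of an irreducible cubic, up to a rational factor.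

  So \<open>y\<^sub>\<sigma>\<close> and \<open>\<sigma> y\<^sub>\<sigma>\<close> are in \<open>C\<close>. The weight \<open>w \<tau> = (\<Prod>\<sigma>\<noteq>1. \<tau> y\<^sub>\<sigma> - \<sigma> y\<^sub>\<sigma>)\<close> vanishes for \<open>\<tau> \<noteq> 1\<close>
  and not for \<open>\<tau> = 1\<close>, while expanding the product shows that the sum of \<open>w \<tau> * \<tau> z\<close> over \<open>G\<close> is a
  combination of traces of elements of \<open>M\<close> with coefficients in \<open>C\<close>. Traces are rational, so
  \<open>w 1 * z\<close>, and with it \<open>z\<close>, lies in \<open>C\<close>.\<close>

section \<open>Subfields of the ambient field\<close>

lemma ambient_simps [simp]:
  "carrier (ambient :: 'a::field_char_0 ring) = UNIV"
  "x \<otimes>\<^bsub>ambient\<^esub> y = x * (y :: 'a)"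
  "x \<oplus>\<^bsub>ambient\<^esub> y = x + (y :: 'a)"
  "\<one>\<^bsub>ambient\<^esub> = (1 :: 'a)"
  "\<zero>\<^bsub>ambient\<^esub> = (0 :: 'a)"
  by (simp_all add: ring_of_type_algebra_def)

lemma field_ambient: "field (ambient :: 'a::field_char_0 ring)"
  by (rule field_from_type_algebra)

lemma ring_ambient: "ring (ambient :: 'a::field_char_0 ring)"
  by (rule ring_from_type_algebra)

lemma a_inv_ambient [simp]: "\<ominus>\<^bsub>ambient\<^esub> x = - (x :: 'a::field_char_0)"
proof -
  interpret field "ambient :: 'a ring" by (rule field_ambient)
  show ?thesis using minus_equality[of "-x" x] by simp
qed

lemma m_inv_ambient [simp]:
  assumes "x \<noteq> 0" shows "inv\<^bsub>ambient\<^esub> x = inverse (x :: 'a::field_char_0)"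
proof -
  interpret field "ambient :: 'a ring" by (rule field_ambient)
  show ?thesis using comm_inv_char[of x "inverse x"] assms by simp
qed

lemma subfield_ambientI:
  fixes K :: "'a::field_char_0 set"
  assumes "1 \<in> K" "\<And>x y. x \<in> K \<Longrightarrow> y \<in> K \<Longrightarrow> x + y \<in> K" "\<And>x y. x \<in> K \<Longrightarrow> y \<in> K \<Longrightarrow> x * y \<in> K"
    "\<And>x. x \<in> K \<Longrightarrow> - x \<in> K" "\<And>x. x \<in> K \<Longrightarrow> x \<noteq> 0 \<Longrightarrow> inverse x \<in> K"
  shows "subfield K ambient"
proof -
  interpret field "ambient :: 'a ring" by (rule field_ambient)
  show ?thesis
    using assms by (intro subfieldI' subringI) auto
qed

context
  fixes K :: "'a::field_char_0 set"
  assumes K: "subfield K ambient"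
begin

lemma subfield_one: "1 \<in> K"
  using subringE(3)[OF subfieldE(1)[OF K]] by simp

lemma subfield_zero: "0 \<in> K"
  using subringE(2)[OF subfieldE(1)[OF K]] by simp

lemma subfield_add: "x \<in> K \<Longrightarrow> y \<in> K \<Longrightarrow> x + y \<in> K"
  using subringE(7)[OF subfieldE(1)[OF K]] by simp

lemma subfield_mult: "x \<in> K \<Longrightarrow> y \<in> K \<Longrightarrow> x * y \<in> K"
  using subringE(6)[OF subfieldE(1)[OF K]] by simp

lemma subfield_uminus: "x \<in> K \<Longrightarrow> - x \<in> K"
  using subringE(5)[OF subfieldE(1)[OF K]] by simp

lemma subfield_diff: "x \<in> K \<Longrightarrow> y \<in> K \<Longrightarrow> x - y \<in> K"
  using subfield_add[of x "-y"] subfield_uminus[of y] by simp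

lemma subfield_inverse: "x \<in> K \<Longrightarrow> inverse x \<in> K"
  using ring.subfield_m_inv(1)[OF ring_ambient K, of x] by (cases "x = 0") auto

lemma subfield_divide: "x \<in> K \<Longrightarrow> y \<in> K \<Longrightarrow> x / y \<in> K"
  using subfield_mult[of x "inverse y"] subfield_inverse[of y] by (simp add: divide_inverse)

lemma subfield_sum: "(\<And>i. i \<in> I \<Longrightarrow> f i \<in> K) \<Longrightarrow> sum f I \<in> K"
  by (induction I rule: infinite_finite_induct) (auto intro: subfield_zero subfield_add)

lemma subfield_prod: "(\<And>i. i \<in> I \<Longrightarrow> f i \<in> K) \<Longrightarrow> prod f I \<in> K"
  by (induction I rule: infinite_finite_induct) (auto intro: subfield_one subfield_mult)

lemma subfield_power: "x \<in> K \<Longrightarrow> x ^ n \<in> K"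
  by (induction n) (auto intro: subfield_one subfield_mult)

lemma subfield_of_nat: "of_nat n \<in> K"
  by (induction n) (auto intro: subfield_zero subfield_one subfield_add)

lemma subfield_of_int: "of_int n \<in> K"
  by (cases n) (auto intro: subfield_of_nat subfield_uminus simp del: of_nat_Suc)

lemma subfield_Rats: "\<rat> \<subseteq> K"
proof
  fix x :: 'a assume "x \<in> \<rat>"
  then obtain a b where "x = of_int a / of_int b"
    by (metis Rats_cases')
  then show "x \<in> K" by (simp add: subfield_divide subfield_of_int)
qed

end

lemmas subfield_intros = subfield_one subfield_zero subfield_add subfield_mult subfield_uminus
  subfield_diff subfield_inverse subfield_divide subfield_sum subfield_prod subfield_power

lemma subfield_ambient_Rats: "subfield (\<rat> :: 'a::field_char_0 set) ambient"
  by (rule subfield_ambientI) auto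

lemma subfield_compositum: "subfield (compositum_of_cubic_fields :: 'a::field_char_0 set) ambient"
  unfolding compositum_of_cubic_fields_def
  by (rule field.generate_field_is_subfield[OF field_ambient]) simp

lemma cubic_field_subset_compositum:
  "number_field_of_degree 3 K \<Longrightarrow> K \<subseteq> compositum_of_cubic_fields"
  unfolding compositum_of_cubic_fields_def by (auto intro: generate_field.incl)


section \<open>Rational polynomials\<close>

abbreviation rat_poly :: "rat poly \<Rightarrow> 'a::field_char_0 \<Rightarrow> 'a" where
  "rat_poly p x \<equiv> poly (map_poly of_rat p) x"

lemma rat_poly_pCons [simp]: "rat_poly (pCons c p) x = of_rat c + x * rat_poly p x"
  by (cases "c = 0 \<and> p = 0") (auto simp: map_poly_pCons)

lemma rat_poly_add [simp]: "rat_poly (p + q) x = rat_poly p x + rat_poly q x"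
  by (induction p q rule: poly_induct2) (simp_all add: of_rat_add algebra_simps)

lemma rat_poly_smult [simp]: "rat_poly (smult c p) x = of_rat c * rat_poly p x"
  by (induction p) (simp_all add: of_rat_mult algebra_simps)

lemma rat_poly_mult [simp]: "rat_poly (p * q) x = rat_poly p x * rat_poly q x"
  by (induction p) (simp_all add: algebra_simps)

text \<open>Otherwise a Bezout identity \<open>a * p + b * g = 1\<close>, evaluated at
  \<open>x\<close>, would read 0 = 1. So \<open>p\<close> serves as the minimal polynomial of
  \<open>x\<close>.\<close>

lemma irreducible_dvd_rat_poly:
  assumes p: "Factorial_Ring.irreducible p" "rat_poly p x = (0 :: 'a::field_char_0)"
    and g: "rat_poly g x = 0"
  shows "p dvd g"
proof (rule ccontr)
  assume "\<not> p dvd g"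
  then have "coprime p g"
    using p(1) by (simp add: prime_elem_imp_coprime prime_elem_iff_irreducible)
  then obtain a b where "a * p + b * g = 1"
    by (metis bezout_coefficients_fst_snd coprime_imp_gcd_eq_1)
  then have "rat_poly (a * p + b * g) x = rat_poly 1 x" by simp
  then show False using p g by simp
qed

text \<open>Of the prime factors of an annihilating rational polynomial, one must vanish at
  \<open>x\<close>.\<close>

lemma algebraic_imp_irreducible_rat_poly:
  fixes x :: "'a::field_char_0"
  assumes "algebraic x"
  obtains p where "Factorial_Ring.irreducible p" "rat_poly p x = 0"
proof -
  obtain q where q: "\<And>i. poly.coeff q i \<in> \<rat>" "q \<noteq> 0" "poly q x = 0"
    using assms algebraic_altdef by metis
  obtain r where r: "q = map_poly of_rat r" using q(1) by (metis ratpolyE)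
  have "r \<noteq> 0" using q(2) r by auto
  then have "rat_poly r x = 0 \<Longrightarrow> \<exists>p. Factorial_Ring.irreducible p \<and> rat_poly p x = 0"
  proof (induction r rule: prime_divisors_induct)
    case (unit u)
    then obtain c where "u = [:c:]" "c \<noteq> 0" by (auto simp: is_unit_poly_iff)
    with unit show ?case by simp
  next
    case (factor p s)
    then show ?case by (auto intro: prime_elem_imp_irreducible)
  qed simp
  then show thesis using q(3) r that by auto
qed

section \<open>Roots of rational cubics lie in the compositum of the cubic fields\<close>

text \<open>The cubic may be reducible, so rationals and quadratic irrationalities are covered;
  orbit sums under a Galois group acting on three points can be of any of these kinds.\<close>

definition rat_cubic_root :: "'a::field_char_0 \<Rightarrow> bool" where
  "rat_cubic_root y \<longleftrightarrow> (\<exists>a\<in>\<rat>. \<exists>b\<in>\<rat>. \<exists>c\<in>\<rat>. y ^ 3 + a * y ^ 2 + b * y + c = 0)"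

text \<open>The cubic equation reduces higher powers of \<open>\<alpha>\<close>, so the span of 1,
  \<open>\<alpha>\<close> and \<open>\<alpha> ^ 2\<close> is the simple extension by
  \<open>\<alpha>\<close>; the independence hypotheses make its dimension exactly 3.\<close>

lemma number_field_of_degree_3:
  fixes \<alpha> :: "'a::field_char_0"
  assumes "rat_cubic_root \<alpha>"
    and indep: "\<alpha> \<notin> \<rat>" "\<And>b c. b \<in> \<rat> \<Longrightarrow> c \<in> \<rat> \<Longrightarrow> \<alpha> ^ 2 \<noteq> b * \<alpha> + c"
  shows "number_field_of_degree 3 {r * \<alpha> ^ 2 + (s * \<alpha> + t) | r s t. r \<in> \<rat> \<and> s \<in> \<rat> \<and> t \<in> \<rat>}"
    (is "number_field_of_degree 3 ?K")
proof -
  interpret field "ambient :: 'a ring" by (rule field_ambient)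
  obtain a b c where abc: "a \<in> \<rat>" "b \<in> \<rat>" "c \<in> \<rat>" "\<alpha> ^ 3 + a * \<alpha> ^ 2 + b * \<alpha> + c = 0"
    using assms(1) unfolding rat_cubic_root_def by blast
  \<comment> \<open>\<open>dimension\<close> is inductive: each new basis vector, here 1, then
    \<open>\<alpha>\<close>, then \<open>\<alpha> ^ 2\<close>, adds a line to a span that does not
    contain it.\<close>
  have line_Rats: "line_extension \<rat> 1 {0} = (\<rat> :: 'a set)"
    by (auto simp: line_extension_mem_iff)
  have line_\<alpha>: "line_extension \<rat> \<alpha> \<rat> = {s * \<alpha> + t | s t. s \<in> \<rat> \<and> t \<in> \<rat>}"
    unfolding set_eq_iff line_extension_mem_iff ambient_simps by blast
  have line_\<alpha>2: "line_extension \<rat> (\<alpha> ^ 2) {s * \<alpha> + t | s t. s \<in> \<rat> \<and> t \<in> \<rat>} = ?K"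
    unfolding set_eq_iff line_extension_mem_iff ambient_simps by blast
  have "dimension (Suc 0) \<rat> (line_extension \<rat> 1 {0})"
    using dimension.zero_dim by (intro dimension.Suc_dim) auto
  then have "dimension (Suc (Suc 0)) \<rat> (line_extension \<rat> \<alpha> \<rat>)"
    using indep(1) unfolding line_Rats by (intro dimension.Suc_dim) auto
  then have "dimension (Suc (Suc (Suc 0))) \<rat> (line_extension \<rat> (\<alpha> ^ 2) {s * \<alpha> + t | s t. s \<in> \<rat> \<and> t \<in> \<rat>})"
    using indep(2) unfolding line_\<alpha> by (intro dimension.Suc_dim) auto
  then have dim: "dimension 3 \<rat> ?K" unfolding line_\<alpha>2 by (simp add: numeral_3_eq_3)
  have KI: "r * \<alpha> ^ 2 + (s * \<alpha> + t) \<in> ?K" if "r \<in> \<rat>" "s \<in> \<rat>" "t \<in> \<rat>" for r s t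
    using that by blast
  \<comment> \<open>Polynomials are coefficient lists here, leading coefficient first.\<close>
  have "[1, a, b, c] \<in> carrier (univ_poly ambient \<rat>)"
    using abc by (simp add: univ_poly_carrier[symmetric] polynomial_def)
  moreover have "eval [1, a, b, c] \<alpha> = 0"
    using abc(4) by (simp add: numeral_3_eq_3 numeral_2_eq_2 algebra_simps)
  ultimately have "(algebraic over \<rat>) \<alpha>"
    by (intro algebraicI) auto
  then have "subfield (simple_extension \<rat> \<alpha>) ambient"
    using simple_extension_is_subfield[OF subfield_ambient_Rats] by simp
  moreover have "simple_extension \<rat> \<alpha> = ?K"
  proof (intro subset_antisym subsetI)
    fix x assume "x \<in> simple_extension \<rat> \<alpha>"
    then show "x \<in> ?K"
    proof induction
      case zero
      show ?case using KI[of 0 0 0] by simp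
    next
      case (lin k1 k2)
      then obtain r s t where rst: "k1 = r * \<alpha> ^ 2 + (s * \<alpha> + t)" "r \<in> \<rat>" "s \<in> \<rat>" "t \<in> \<rat>" by blast
      \<comment> \<open>The last summand, \<open>r\<close> times the cubic, is 0 and absorbs the
        term in \<open>\<alpha> ^ 3\<close>.\<close>
      have "k1 * \<alpha> + k2 = (s - r * a) * \<alpha> ^ 2 + ((t - r * b) * \<alpha> + (k2 - r * c))
          + r * (\<alpha> ^ 3 + a * \<alpha> ^ 2 + b * \<alpha> + c)"
        unfolding rst(1) by (simp add: algebra_simps power2_eq_square power3_eq_cube)
      also have "\<dots> = (s - r * a) * \<alpha> ^ 2 + ((t - r * b) * \<alpha> + (k2 - r * c))"
        by (simp add: abc(4))
      also have "\<dots> \<in> ?K" using rst lin abc by (intro KI) auto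
      finally show ?case by (simp only: ambient_simps)
    qed
  next
    fix x assume "x \<in> ?K"
    then obtain r s t where rst: "x = r * \<alpha> ^ 2 + (s * \<alpha> + t)" "r \<in> \<rat>" "s \<in> \<rat>" "t \<in> \<rat>" by blast
    have "r \<in> simple_extension \<rat> \<alpha>"
      using simple_extension_incl[of \<rat> \<alpha>] rst(2) by auto
    from simple_extension.lin[OF simple_extension.lin[OF this rst(3)] rst(4)]
    have "(r * \<alpha> + s) * \<alpha> + t \<in> simple_extension \<rat> \<alpha>" by simp
    then show "x \<in> simple_extension \<rat> \<alpha>"
      unfolding rst(1) by (simp add: algebra_simps power2_eq_square)
  qed
  ultimately show ?thesis
    using dim by (simp add: number_field_of_degree_def)
qed

lemma cubic_generator_in_compositum:
  fixes \<alpha> :: "'a::field_char_0"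
  assumes "rat_cubic_root \<alpha>" "\<alpha> \<notin> \<rat>" "\<And>b c. b \<in> \<rat> \<Longrightarrow> c \<in> \<rat> \<Longrightarrow> \<alpha> ^ 2 \<noteq> b * \<alpha> + c"
  shows "\<alpha> \<in> compositum_of_cubic_fields"
proof -
  have "\<alpha> \<in> {r * \<alpha> ^ 2 + (s * \<alpha> + t) | r s t. r \<in> \<rat> \<and> s \<in> \<rat> \<and> t \<in> \<rat>}"
    by (intro CollectI exI[of _ 0] exI[of _ 1]) simp
  then show ?thesis
    using cubic_field_subset_compositum[OF number_field_of_degree_3[OF assms]] by blast
qed

section \<open>Square roots of rational numbers from discriminants of cubics\<close>

lemma trinomial_no_rational_root:
  fixes n :: int and y :: "'a::field_char_0"
  assumes n: "3 dvd n" "\<not> 27 dvd n" and y: "y \<in> \<rat>"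
  shows "y ^ 3 - of_int n * y - 2 * of_int n \<noteq> 0"
proof
  assume eq: "y ^ 3 - of_int n * y - 2 * of_int n = 0"
  obtain a b :: int where ab: "y = of_int a / of_int b" "b > 0" "coprime a b"
    using y by (metis Rats_cases')
  \<comment> \<open>Denominators are cleared. The rest is 3-adic: 3 divides \<open>a\<close>, hence
    neither \<open>b\<close> nor \<open>a + 2 * b\<close>, so the factor 27 of \<open>a ^ 3\<close>
    must divide \<open>n\<close>.\<close>
  have "of_int (a ^ 3) = (of_int (n * (a + 2 * b) * b ^ 2) :: 'a)"
    using eq ab(1,2) by (simp add: field_simps power2_eq_square power3_eq_cube)
  then have eq: "a ^ 3 = n * (a + 2 * b) * b ^ 2"
    by (simp only: of_int_eq_iff)
  have "prime (3 :: int)" by simp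
  have "3 dvd a ^ 3" unfolding eq using n(1) by simp
  then have "3 dvd a" using \<open>prime 3\<close> prime_dvd_power by blast
  then have "\<not> 3 dvd b" using ab(3) by (metis coprime_common_divisor_int abs_numeral numeral_eq_one_iff semiring_norm(86))
  then have "\<not> 3 dvd (a + 2 * b) * b ^ 2"
    using \<open>3 dvd a\<close> \<open>prime 3\<close>
    by (auto simp: prime_dvd_mult_iff prime_dvd_power_iff dvd_add_right_iff)
  then have "coprime 3 ((a + 2 * b) * b ^ 2)"
    using \<open>prime 3\<close> by (rule prime_imp_coprime[rotated])
  then have "coprime (3 ^ 3) ((a + 2 * b) * b ^ 2)"
    by (metis coprime_power_left_iff)
  moreover have "3 ^ 3 dvd n * ((a + 2 * b) * b ^ 2)"
    using \<open>3 dvd a\<close> eq dvd_power_same[of 3 a 3] by (simp add: mult.assoc)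
  ultimately have "3 ^ 3 dvd n" by (simp add: coprime_dvd_mult_left_iff del: power_numeral)
  then show False using n(2) by simp
qed

lemma trinomial_root_in_compositum:
  fixes n :: int and y :: "'a::field_char_0"
  assumes n: "3 dvd n" "\<not> 27 dvd n" and y: "y ^ 3 - of_int n * y - 2 * of_int n = 0"
  shows "y \<in> compositum_of_cubic_fields"
proof (rule cubic_generator_in_compositum)
  show "rat_cubic_root y"
    unfolding rat_cubic_root_def
    using y by (intro bexI[of _ 0] bexI[of _ "- of_int n"] bexI[of _ "- 2 * of_int n"]) auto
  show irrat: "y \<notin> \<rat>" using trinomial_no_rational_root[OF n] y by blast
  fix b c :: 'a assume bc: "b \<in> \<rat>" "c \<in> \<rat>"
  show "y ^ 2 \<noteq> b * y + c"
  proof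
    assume y2: "y ^ 2 = b * y + c"
    \<comment> \<open>Dividing the cubic by \<open>Y ^ 2 - b * Y - c\<close> gives quotient
      \<open>Y + b\<close> and remainder \<open>?d * Y + ?e\<close>. The irrational root
      \<open>y\<close> forces the remainder to be 0, and then \<open>- b\<close> is a rational
      root.\<close>
    let ?d = "b ^ 2 + c - of_int n" and ?e = "b * c - 2 * of_int n"
    have "y ^ 3 = y * y ^ 2" by (simp add: power3_eq_cube power2_eq_square)
    also have "\<dots> = (b * y + c) * y" unfolding y2 by simp
    also have "\<dots> = b * y ^ 2 + c * y" by (simp add: algebra_simps power2_eq_square)
    also have "\<dots> = (b ^ 2 + c) * y + b * c" unfolding y2 by (simp add: algebra_simps power2_eq_square)
    finally have de: "?d * y + ?e = 0" using y by (simp add: algebra_simps)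
    have d0: "?d = 0"
    proof (rule ccontr)
      assume "?d \<noteq> 0"
      then have "y = - ?e / ?d" using de by (simp add: field_simps eq_neg_iff_add_eq_0)
      moreover have "- ?e / ?d \<in> \<rat>" using bc by auto
      ultimately show False using irrat by simp
    qed
    then have e0: "?e = 0" using de by simp
    have "(- b) ^ 3 - of_int n * (- b) - 2 * of_int n = ?e - b * ?d"
      by (simp add: algebra_simps power2_eq_square power3_eq_cube)
    also have "\<dots> = 0" using d0 e0 by simp
    finally show False using trinomial_no_rational_root[OF n, of "- b"] bc by simp
  qed
qed

text \<open>The cubic \<open>y\<^sup>3 - n y - 2 n\<close> has discriminant \<open>4 n\<^sup>2 (n - 27)\<close>, so \<open>n = 27 + e\<close>
  produces a square root of \<open>e\<close>.\<close>

lemma sqrt_int_in_compositum_if_3_dvd: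
  fixes e :: int and s :: "'a::{alg_closed_field, field_char_0}"
  assumes e: "3 dvd e" "\<not> 27 dvd e" and s: "s ^ 2 = of_int e"
  shows "s \<in> compositum_of_cubic_fields"
proof -
  define n where "n = 27 + e"
  have n: "3 dvd n" "\<not> 27 dvd n" using e by (auto simp: n_def dvd_add_right_iff)
  define N :: 'a where "N = of_int n"
  have N0: "N \<noteq> 0" using n by (auto simp: N_def)
  have s2: "s ^ 2 = N - 27" by (simp add: s N_def n_def)
  obtain u where u: "poly [:- 2 * N, - N, 0, 1:] u = 0"
    using alg_closed_imp_poly_has_root[of "[:- 2 * N, - N, 0, 1:]"] by auto
  \<comment> \<open>The quadratic is the quotient of the cubic by \<open>Y - u\<close>. The third
    root \<open>w\<close> follows because the roots sum to 0.\<close>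
  obtain v where v: "poly [:u ^ 2 - N, u, 1:] v = 0"
    using alg_closed_imp_poly_has_root[of "[:u ^ 2 - N, u, 1:]"] by auto
  define w where "w = - u - v"
  have u': "u ^ 3 = N * u + 2 * N"
    using u by (simp add: algebra_simps power3_eq_cube add_eq_0_iff2)
  have v': "v ^ 2 = N - u ^ 2 - u * v"
    using v by (simp add: algebra_simps power2_eq_square add_eq_0_iff2)
  have uC: "u \<in> compositum_of_cubic_fields"
    using u' by (intro trinomial_root_in_compositum[OF n]) (simp add: N_def)
  have "v ^ 3 - N * v - 2 * N = 0" 
  proof -
    have "v ^ 3 - N * v - 2 * N = (u ^ 3 - (N * u + 2 * N)) + (v - u) * (v ^ 2 - (N - u ^ 2 - u * v))"
      by (simp add: algebra_simps power2_eq_square power3_eq_cube)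
    then show ?thesis using u' v' by simp
  qed
  then have vC: "v \<in> compositum_of_cubic_fields"
    by (intro trinomial_root_in_compositum[OF n]) (simp add: N_def)
  note C = subfield_compositum
  have wC: "w \<in> compositum_of_cubic_fields"
    unfolding w_def by (intro subfield_intros[OF C] uC vC)
  \<comment> \<open>The square of this product of root differences is the discriminant
    \<open>4 * N ^ 2 * (N - 27)\<close>.\<close>
  define \<delta> where "\<delta> = (u - v) * (v - w) * (w - u)"
  have \<delta>C: "\<delta> \<in> compositum_of_cubic_fields"
    unfolding \<delta>_def by (intro subfield_intros[OF C] uC vC wC)
  have "\<delta> ^ 2 = (2 * N * s) ^ 2"

  proof -
    \<comment> \<open>With \<open>w\<close> eliminated, the computation rests on the relations
      \<open>u ^ 2 + u * v + v ^ 2 = N\<close> and \<open>u * v * (u + v) = - 2 * N\<close>.\<close>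
    have "\<delta> = (v - u) * (2 * u ^ 2 + 5 * (u * v) + 2 * v ^ 2)"
      unfolding \<delta>_def w_def by (simp add: algebra_simps power2_eq_square)
    also have "2 * u ^ 2 + 5 * (u * v) + 2 * v ^ 2 = 2 * N + 3 * (u * v)"
      unfolding v' by (simp add: algebra_simps)
    finally have "\<delta> ^ 2 = (v - u) ^ 2 * (2 * N + 3 * (u * v)) ^ 2"
      by (simp add: power_mult_distrib)
    also have "(v - u) ^ 2 = N - 3 * (u * v)"
      unfolding power2_diff v' by (simp add: algebra_simps)
    also have "(N - 3 * (u * v)) * (2 * N + 3 * (u * v)) ^ 2 = 4 * N ^ 3 - 27 * ((u * v) ^ 2 * (N + u * v))"
      by (simp add: algebra_simps power2_eq_square power3_eq_cube)
    also have "N + u * v = (u + v) ^ 2"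
      unfolding power2_sum v' by (simp add: algebra_simps)
    also have "(u * v) ^ 2 * (u + v) ^ 2 = (u * v * (u + v)) ^ 2"
      by (simp add: power_mult_distrib)
    also have "u * v * (u + v) = u ^ 2 * v + u * v ^ 2"
      by (simp add: algebra_simps power2_eq_square)
    also have "\<dots> = N * u - u ^ 3"
      unfolding v' by (simp add: algebra_simps power2_eq_square power3_eq_cube)
    also have "\<dots> = - 2 * N" unfolding u' by simp
    also have "4 * N ^ 3 - 27 * (- 2 * N) ^ 2 = (2 * N) ^ 2 * s ^ 2"
      unfolding s2 by (simp add: algebra_simps power2_eq_square power3_eq_cube)
    finally show ?thesis by (simp add: power_mult_distrib)
  qed
  then have "\<delta> = 2 * N * s \<or> \<delta> = - (2 * N * s)" by (simp add: power2_eq_iff)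
  then have "s = \<delta> / (2 * N) \<or> s = - (\<delta> / (2 * N))" using N0 by (auto simp: field_simps)
  moreover have "2 * N \<in> compositum_of_cubic_fields"
    using subfield_of_int[OF C, of "2 * n"] by (simp add: N_def)
  ultimately show ?thesis using \<delta>C by (auto intro: subfield_intros[OF C])
qed

text \<open>Scaling \<open>s\<close> by 3 changes the 3-adic valuation of a nonzero \<open>e\<close>
  by 2. Multiplying once (valuation 0) or dividing repeatedly (valuation at least 3) leads to
  valuation 1 or 2, the case already settled.\<close>

lemma sqrt_int_in_compositum:
  fixes e :: int and s :: "'a::{alg_closed_field, field_char_0}"
  assumes "s ^ 2 = of_int e"
  shows "s \<in> compositum_of_cubic_fields"
  using assms
proof (induction "nat \<bar>e\<bar>" arbitrary: e s rule: less_induct)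
  case less
  note C = subfield_compositum
  consider "e = 0" | "\<not> 3 dvd e" | "3 dvd e" "\<not> 27 dvd e" | "e \<noteq> 0" "27 dvd e" by blast
  then show ?case
  proof cases
    case 1
    then show ?thesis using less.prems subfield_zero[OF C] by simp
  next
    case 2
    have "3 * s \<in> compositum_of_cubic_fields"
    proof (rule sqrt_int_in_compositum_if_3_dvd)
      show "3 dvd 9 * e" "\<not> 27 dvd 9 * e" using 2 by presburger+
      show "(3 * s) ^ 2 = of_int (9 * e)" using less.prems by (simp add: power_mult_distrib)
    qed
    then show ?thesis
      using subfield_divide[OF C, of "3 * s" 3] subfield_of_int[OF C, of 3] by simp
  next
    case 3
    then show ?thesis using sqrt_int_in_compositum_if_3_dvd less.prems by blast
  next
    case 4
    then obtain k where k: "e = 9 * k" by (auto elim!: dvdE intro: that[of "3 * _"])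
    have "s / 3 \<in> compositum_of_cubic_fields"
    proof (rule less.hyps)
      show "nat \<bar>k\<bar> < nat \<bar>e\<bar>" using 4 k by simp
      show "(s / 3) ^ 2 = of_int k" using less.prems k by (simp add: power_divide)
    qed
    then show ?thesis
      using subfield_mult[OF C, of "s / 3" 3] subfield_of_int[OF C, of 3] by simp
  qed
qed

lemma sqrt_Rats_in_compositum:
  fixes s :: "'a::{alg_closed_field, field_char_0}"
  assumes "s ^ 2 \<in> \<rat>"
  shows "s \<in> compositum_of_cubic_fields"
proof -
  obtain a b :: int where ab: "s ^ 2 = of_int a / of_int b" "b > 0"
    using assms by (metis Rats_cases')
  have "of_int b * s \<in> compositum_of_cubic_fields"
  proof (rule sqrt_int_in_compositum)
    have "(of_int b * s) ^ 2 = of_int b * of_int b * s ^ 2"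
      by (simp add: power2_eq_square)
    also have "\<dots> = of_int (a * b)" using ab by simp
    finally show "(of_int b * s) ^ 2 = of_int (a * b)" .
  qed
  then have "of_int b * s / of_int b \<in> compositum_of_cubic_fields"
    using subfield_of_int[OF subfield_compositum] by (rule subfield_divide[OF subfield_compositum])
  then show ?thesis using ab(2) by simp
qed

text \<open>Either \<open>\<alpha>\<close> satisfies a rational quadratic, and completing the square
  expresses it by a square root of a rational, or it generates a cubic field.\<close>

lemma rat_cubic_root_in_compositum:
  fixes \<alpha> :: "'a::{alg_closed_field, field_char_0}"
  assumes "rat_cubic_root \<alpha>"
  shows "\<alpha> \<in> compositum_of_cubic_fields"
proof (cases "\<exists>b\<in>\<rat>. \<exists>c\<in>\<rat>. \<alpha> ^ 2 = b * \<alpha> + c")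
  case True
  note C = subfield_compositum
  obtain b c where bc: "b \<in> \<rat>" "c \<in> \<rat>" "\<alpha> ^ 2 = b * \<alpha> + c" using True by blast
  have "(2 * \<alpha> - b) ^ 2 = b ^ 2 + 4 * c"
    by (simp add: power2_diff power_mult_distrib bc(3) algebra_simps)
  then have "2 * \<alpha> - b \<in> compositum_of_cubic_fields"
    using bc by (intro sqrt_Rats_in_compositum) simp
  moreover have "b \<in> compositum_of_cubic_fields" "2 \<in> compositum_of_cubic_fields"
    using subfield_Rats[OF C] bc(1) by auto
  ultimately have "((2 * \<alpha> - b) + b) / 2 \<in> compositum_of_cubic_fields"
    by (intro subfield_divide[OF C] subfield_add[OF C])
  then show ?thesis by simp
next
  case False
  \<comment> \<open>A rational \<open>\<alpha>\<close> would satisfy a quadratic with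
    \<open>b = 0\<close> and \<open>c = \<alpha> ^ 2\<close>.\<close>
  then have "\<alpha> \<notin> \<rat>" using bexI[of "\<lambda>b. \<exists>c\<in>\<rat>. \<alpha> ^ 2 = b * \<alpha> + c" 0 \<rat>] by (auto dest: Rats_power)
  then show ?thesis using False assms by (intro cubic_generator_in_compositum) auto
qed

section \<open>Extending embeddings to the algebraic closure\<close>

text \<open>A partial endomorphism is encoded by its graph, so that Zorn's lemma applies to inclusion.
  The domain is a subring containing the rationals; as all elements will be algebraic, it is
  a field, and injectivity need not be part of the definition.\<close>

definition partial_endo :: "('a::field_char_0 \<times> 'a) set \<Rightarrow> bool" where
  "partial_endo R \<longleftrightarrow> (\<forall>q. (of_rat q, of_rat q) \<in> R) \<and>
     (\<forall>a b c d. (a, b) \<in> R \<longrightarrow> (c, d) \<in> R \<longrightarrow> (a + c, b + d) \<in> R \<and> (a * c, b * d) \<in> R) \<and>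
     (\<forall>b. (0, b) \<in> R \<longrightarrow> b = 0)"

text \<open>Expresses that \<open>h\<close> arises from \<open>g\<close> by applying
  \<open>R\<close> to the coefficients, without choosing a function for \<open>R\<close>.\<close>

definition poly_rel :: "('a::field_char_0 \<times> 'a) set \<Rightarrow> 'a poly \<Rightarrow> 'a poly \<Rightarrow> bool" where
  "poly_rel R g h \<longleftrightarrow> (\<forall>i. (poly.coeff g i, poly.coeff h i) \<in> R)"

context
  fixes R :: "('a::field_char_0 \<times> 'a) set"
  assumes R: "partial_endo R"
begin

lemma partial_endo_rat: "(of_rat q, of_rat q) \<in> R"
  and partial_endo_add: "(a, b) \<in> R \<Longrightarrow> (c, d) \<in> R \<Longrightarrow> (a + c, b + d) \<in> R"
  and partial_endo_mult: "(a, b) \<in> R \<Longrightarrow> (c, d) \<in> R \<Longrightarrow> (a * c, b * d) \<in> R"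
  and partial_endo_zeroD: "(0, b) \<in> R \<Longrightarrow> b = 0"
  using R unfolding partial_endo_def by blast+

lemma partial_endo_zero: "(0, 0) \<in> R"
  using partial_endo_rat[of 0] by simp

lemma partial_endo_one: "(1, 1) \<in> R"
  using partial_endo_rat[of 1] by simp

lemma partial_endo_diff:
  assumes "(a, b) \<in> R" "(c, d) \<in> R" shows "(a - c, b - d) \<in> R"
proof -
  have "(of_rat (-1), of_rat (-1)) \<in> R" by (rule partial_endo_rat)
  then have "(-1, -1) \<in> R" by simp
  from partial_endo_add[OF assms(1) partial_endo_mult[OF this assms(2)]] show ?thesis by simp
qed

lemma partial_endo_unique: "(a, b) \<in> R \<Longrightarrow> (a, c) \<in> R \<Longrightarrow> b = c"
  using partial_endo_diff[of a b a c] partial_endo_zeroD by fastforce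

lemma partial_endo_sum:
  "(\<And>i. i \<in> I \<Longrightarrow> (f i, g i) \<in> R) \<Longrightarrow> (sum f I, sum g I) \<in> R"
  by (induction I rule: infinite_finite_induct)
    (auto intro: partial_endo_zero partial_endo_add)

lemma partial_endo_poly:
  assumes "poly_rel R g h" "(a, b) \<in> R"
  shows "(poly g a, poly h b) \<in> R"
  using assms(1)
proof (induction g h rule: poly_induct2)
  case (pCons c p d q)
  have "(c, d) \<in> R"
    using pCons(2)[unfolded poly_rel_def, rule_format, of 0] by simp
  moreover have "poly_rel R p q"
    unfolding poly_rel_def
    using pCons(2)[unfolded poly_rel_def, rule_format, of "Suc _"] by simp
  ultimately show ?case
    using pCons(1) assms(2) by (auto intro: partial_endo_add partial_endo_mult)
qed (simp add: partial_endo_zero)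

lemma poly_rel_rat: "poly_rel R (map_poly of_rat p) (map_poly of_rat p)"
  by (simp add: poly_rel_def coeff_map_poly partial_endo_rat)

lemma poly_rel_add: "poly_rel R g h \<Longrightarrow> poly_rel R g' h' \<Longrightarrow> poly_rel R (g + g') (h + h')"
  by (simp add: poly_rel_def partial_endo_add)

lemma poly_rel_diff: "poly_rel R g h \<Longrightarrow> poly_rel R g' h' \<Longrightarrow> poly_rel R (g - g') (h - h')"
  by (simp add: poly_rel_def partial_endo_diff)

lemma poly_rel_mult: "poly_rel R g h \<Longrightarrow> poly_rel R g' h' \<Longrightarrow> poly_rel R (g * g') (h * h')"
  by (simp add: poly_rel_def coeff_mult partial_endo_sum partial_endo_mult)

lemma poly_rel_monom: "(a, b) \<in> R \<Longrightarrow> poly_rel R (monom a n) (monom b n)"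
  by (simp add: poly_rel_def partial_endo_zero)

lemma poly_rel_pCons: "(a, b) \<in> R \<Longrightarrow> poly_rel R g h \<Longrightarrow> poly_rel R (pCons a g) (pCons b h)"
  by (simp add: poly_rel_def coeff_pCons split: nat.split)

text \<open>If \<open>a\<close> goes to 0, then the value 0 of its irreducible polynomial
  \<open>p\<close> at \<open>a\<close> goes to the value of \<open>p\<close> at 0, which is
  therefore 0. Hence \<open>p\<close> divides X, and its root \<open>a\<close> is 0.\<close>

lemma partial_endo_inj:
  assumes "algebraic a" "(a, 0) \<in> R" shows "a = 0"
proof (rule ccontr)
  assume "a \<noteq> 0"
  obtain p where p: "Factorial_Ring.irreducible p" "rat_poly p a = 0"
    using algebraic_imp_irreducible_rat_poly[OF assms(1)] .
  have "(rat_poly p a, rat_poly p 0) \<in> R"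
    by (rule partial_endo_poly[OF poly_rel_rat assms(2)])
  then have "rat_poly p (0 :: 'a) = 0"
    using p(2) partial_endo_zeroD by simp
  then have "rat_poly [:0, 1:] (0 :: 'a) = 0" "p dvd [:0, 1:]"
    using irreducible_dvd_rat_poly[OF p(1), of 0 "[:0, 1:]"] by auto
  then obtain q where q: "[:0, 1:] = p * q" by (elim dvdE)
  then have "Polynomial.degree p + Polynomial.degree q = 1"
    by (metis degree_mult_eq degree_pCons_eq_if mult_eq_0_iff one_neq_zero pCons_eq_0_iff degree_0 One_nat_def)
  then have "rat_poly (p * q) a = 0" using p(2) by simp
  then show False using \<open>a \<noteq> 0\<close> unfolding q[symmetric] by simp
qed

end

text \<open>The minimal polynomial \<open>\<mu>\<close> of \<open>u\<close> over the domain of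
  \<open>R\<close> is transported by \<open>R\<close> to some \<open>\<nu>\<close>, and
  \<open>u\<close> is sent to a root \<open>v\<close> of \<open>\<nu>\<close>.\<close>

lemma partial_endo_extend:
  fixes R :: "('a::{alg_closed_field, field_char_0} \<times> 'a) set"
  assumes R: "partial_endo R" and alg: "\<forall>x::'a. algebraic x"
  obtains R' v where "partial_endo R'" "R \<subseteq> R'" "(u, v) \<in> R'"
proof -
  define P where "P g \<longleftrightarrow> g \<noteq> 0 \<and> poly g u = 0 \<and> (\<exists>h. poly_rel R g h)" for g
  obtain p where "Factorial_Ring.irreducible p" "rat_poly p u = 0"
    using algebraic_imp_irreducible_rat_poly alg by metis
  then have "P (map_poly of_rat p)"
    unfolding P_def using poly_rel_rat[OF R] by (auto simp: map_poly_eq_0_iff)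
  then obtain \<mu> where \<mu>: "P \<mu>" and min: "\<And>g. P g \<Longrightarrow> Polynomial.degree \<mu> \<le> Polynomial.degree g"
    using ex_has_least_nat[of P "map_poly of_rat p" Polynomial.degree] by blast
  then obtain \<nu> where \<nu>: "poly_rel R \<mu> \<nu>" by (auto simp: P_def)
  \<comment> \<open>Only 0 corresponds to 0 under \<open>R\<close>, so \<open>\<nu>\<close> keeps
    the degree of \<open>\<mu>\<close> and is not constant.\<close>
  have coeffs: "poly.coeff \<nu> i = 0 \<longleftrightarrow> poly.coeff \<mu> i = 0" for i
    using \<nu> partial_endo_inj[OF R] partial_endo_zeroD[OF R] alg unfolding poly_rel_def by metis
  then have deg: "Polynomial.degree \<nu> = Polynomial.degree \<mu>"
    by (simp add: Polynomial.degree_def)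
  have "Polynomial.degree \<mu> > 0"
  proof (rule ccontr)
    assume "\<not> ?thesis"
    then obtain c where "\<mu> = [:c:]" by (auto elim: degree_eq_zeroE)
    then show False using \<mu> by (auto simp: P_def)
  qed
  then obtain v where v: "poly \<nu> v = 0"
    using alg_closed_imp_poly_has_root deg by metis
  \<comment> \<open>This makes \<open>poly g u \<mapsto> poly h v\<close> well defined. By induction
    on the degree, \<open>g\<close> is reduced modulo \<open>\<mu>\<close> while \<open>h\<close> is
    reduced in parallel modulo \<open>\<nu>\<close>.\<close>
  have root: "poly h v = 0" if "poly_rel R g h" "poly g u = 0" for g h
    using that
  proof (induction "Polynomial.degree g" arbitrary: g h rule: less_induct)
    case less
    show ?case
    proof (cases "g = 0")
      case True
      then have "h = 0"
        using less(2) partial_endo_zeroD[OF R] by (intro poly_eqI) (auto simp: poly_rel_def)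
      then show ?thesis by simp
    next
      case False
      then have le: "Polynomial.degree \<mu> \<le> Polynomial.degree g"
        using less.prems by (intro min) (auto simp: P_def)
      define k where "k = Polynomial.degree g - Polynomial.degree \<mu>"
      \<comment> \<open>Pseudo-division: \<open>g\<close> is multiplied by the leading coefficient
        of \<open>\<mu>\<close>, because \<open>partial_endo\<close> provides ring operations only.
        \<open>h'\<close> uses the partners under \<open>R\<close> of the same coefficients.\<close>
      define g' where "g' = [:lead_coeff \<mu>:] * g - monom (lead_coeff g) k * \<mu>"
      define h' where "h' = [:lead_coeff \<nu>:] * h - monom (poly.coeff h (Polynomial.degree g)) k * \<nu>"
      have "poly_rel R [:0:] [:0:]"
        by (simp add: poly_rel_def partial_endo_zero[OF R])
      then have rel: "poly_rel R g' h'"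
        unfolding g'_def h'_def deg using less.prems(1) \<nu>
        by (intro poly_rel_diff[OF R] poly_rel_mult[OF R] poly_rel_monom[OF R] poly_rel_pCons[OF R])
          (auto simp: poly_rel_def)
      have "g' = 0 \<or> Polynomial.degree g' < Polynomial.degree g"
      proof (rule disjCI)
        assume "\<not> Polynomial.degree g' < Polynomial.degree g"
        moreover have "Polynomial.degree g' \<le> Polynomial.degree g"
          unfolding g'_def k_def using le
          by (intro degree_diff_le order.trans[OF degree_mult_le])
            (auto intro: order.trans[OF add_right_mono[OF degree_monom_le]])
        moreover have "poly.coeff (monom (lead_coeff g) k * \<mu>) (Polynomial.degree g)
            = lead_coeff g * lead_coeff \<mu>"
          using le by (simp add: coeff_monom_mult k_def)
        then have "poly.coeff g' (Polynomial.degree g) = 0"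
          unfolding g'_def by simp
        ultimately show "g' = 0"
          by (metis le_neq_implies_less leading_coeff_0_iff)
      qed
      then have "poly h' v = 0"
      proof
        assume "g' = 0"
        then have "h' = 0"
          using rel partial_endo_zeroD[OF R] by (intro poly_eqI) (auto simp: poly_rel_def)
        then show ?thesis by simp
      next
        assume "Polynomial.degree g' < Polynomial.degree g"
        moreover have "poly g' u = 0"
          using \<mu> less.prems by (simp add: g'_def P_def)
        ultimately show ?thesis using less.hyps rel by blast
      qed
      then have "lead_coeff \<nu> * poly h v = 0"
        using v by (simp add: h'_def)
      moreover have "lead_coeff \<nu> \<noteq> 0"
        using coeffs \<mu> unfolding deg P_def by simp
      ultimately show ?thesis by simp
    qed
  qed
  define R' where "R' = {(poly g u, poly h v) | g h. poly_rel R g h}"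
  have const: "poly_rel R [:a:] [:b:]" if "(a, b) \<in> R" for a b
    using poly_rel_monom[OF R that, of 0] by (simp add: monom_0)
  have "R \<subseteq> R'"
  proof
    fix z assume "z \<in> R"
    then obtain a b where "z = (a, b)" "(a, b) \<in> R" by (cases z) auto
    then show "z \<in> R'"
      unfolding R'_def using const[of a b] by (force intro: exI[of _ "[:a:]"] exI[of _ "[:b:]"])
  qed
  moreover have "(u, v) \<in> R'"
    unfolding R'_def
    using poly_rel_pCons[OF R partial_endo_zero[OF R] const[OF partial_endo_one[OF R]]] by force
  moreover have "partial_endo R'"
    unfolding partial_endo_def
  proof (intro conjI allI impI)
    show "(of_rat q, of_rat q) \<in> R'" for q
      using partial_endo_rat[OF R] \<open>R \<subseteq> R'\<close> by blast
    show "b = 0" if "(0, b) \<in> R'" for b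
      using that root unfolding R'_def by auto
    fix a b c d assume "(a, b) \<in> R'" "(c, d) \<in> R'"
    then obtain g h g' h' where gh: "poly_rel R g h" "a = poly g u" "b = poly h v"
      "poly_rel R g' h'" "c = poly g' u" "d = poly h' v"
      unfolding R'_def by auto
    show "(a + c, b + d) \<in> R'"
      unfolding R'_def using poly_rel_add[OF R gh(1,4)] gh by force
    show "(a * c, b * d) \<in> R'"
      unfolding R'_def using poly_rel_mult[OF R gh(1,4)] gh by force
  qed
  ultimately show thesis using that by blast
qed

text \<open>Any two pairs already lie in one member of the chain. This supplies the upper bounds for
  Zorn's lemma.\<close>

lemma partial_endo_Union:
  assumes "C \<noteq> {}" "\<And>R. R \<in> C \<Longrightarrow> partial_endo R" "\<And>R S. R \<in> C \<Longrightarrow> S \<in> C \<Longrightarrow> R \<subseteq> S \<or> S \<subseteq> R"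
  shows "partial_endo (\<Union>C)"
  unfolding partial_endo_def
proof (intro conjI allI impI)
  show "(of_rat q, of_rat q) \<in> \<Union>C" for q
    using assms(1,2) partial_endo_rat by blast
  show "b = 0" if "(0, b) \<in> \<Union>C" for b
    using that assms(2) partial_endo_zeroD by blast
  fix a b c d assume "(a, b) \<in> \<Union>C" "(c, d) \<in> \<Union>C"
  then obtain S T where "S \<in> C" "T \<in> C" "(a, b) \<in> S" "(c, d) \<in> T" by blast
  then obtain R where R: "R \<in> C" "(a, b) \<in> R" "(c, d) \<in> R"
    using assms(3)[of S T] by blast
  show "(a + c, b + d) \<in> \<Union>C" "(a * c, b * d) \<in> \<Union>C"
    using partial_endo_add[OF assms(2)[OF R(1)] R(2,3)]
      partial_endo_mult[OF assms(2)[OF R(1)] R(2,3)] R(1) by blast+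
qed

lemma conjugate_endomorphism:
  fixes x y :: "'a::{alg_closed_field, field_char_0}"
  assumes alg: "\<forall>x::'a. algebraic x"
    and p: "Factorial_Ring.irreducible p" "rat_poly p x = 0" "rat_poly p y = 0"
  obtains \<phi> :: "'a \<Rightarrow> 'a" where "\<phi> x = y" "\<And>a b. \<phi> (a + b) = \<phi> a + \<phi> b"
    "\<And>a b. \<phi> (a * b) = \<phi> a * \<phi> b" "\<And>q. \<phi> (of_rat q) = of_rat q"
proof -
  define A where "A = {R. partial_endo R \<and> (x, y) \<in> R}"
  \<comment> \<open>The starting point is the map from \<rat>[x] to \<rat>[y] taking
    \<open>x\<close> to \<open>y\<close>; it is well defined because \<open>p\<close> divides every
    polynomial with root \<open>x\<close>.\<close>
  define R0 where "R0 = {(rat_poly g x, rat_poly g y) | g. True}"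
  have "R0 \<in> A"
    unfolding A_def partial_endo_def
  proof (intro CollectI conjI allI impI)
    show "(of_rat q, of_rat q) \<in> R0" for q
      unfolding R0_def by (intro CollectI exI[of _ "[:q:]"]) simp
    show "(x, y) \<in> R0"
      unfolding R0_def by (intro CollectI exI[of _ "[:0, 1:]"]) simp
    show "b = 0" if b: "(0, b) \<in> R0" for b
    proof -
      obtain g where g: "0 = rat_poly g x" "b = rat_poly g y" using b unfolding R0_def by blast
      obtain k where "g = p * k" using irreducible_dvd_rat_poly[OF p(1,2) g(1)[symmetric]] by (elim dvdE)
      then show ?thesis using p(3) g(2) by simp
    qed
    fix a b c d assume "(a, b) \<in> R0" "(c, d) \<in> R0"
    then obtain g g' where "a = rat_poly g x" "b = rat_poly g y" "c = rat_poly g' x" "d = rat_poly g' y"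
      unfolding R0_def by auto
    then show "(a + c, b + d) \<in> R0" "(a * c, b * d) \<in> R0"
      unfolding R0_def by (force intro: exI[of _ "g + g'"] exI[of _ "g * g'"])+
  qed
  then have "\<exists>M\<in>A. \<forall>S\<in>A. M \<subseteq> S \<longrightarrow> S = M"
  proof (intro subset_Zorn_nonempty)
    fix C assume C: "C \<noteq> {}" "subset.chain A C"
    then have "partial_endo (\<Union>C)"
      by (intro partial_endo_Union) (auto simp: A_def subset_chain_def)
    then show "\<Union>C \<in> A" using C by (auto simp: A_def subset_chain_def)
  qed auto
  then obtain R where R: "partial_endo R" "(x, y) \<in> R"
    and max: "\<And>S. partial_endo S \<Longrightarrow> R \<subseteq> S \<Longrightarrow> S = R"
    unfolding A_def by blast
  \<comment> \<open>A maximal relation is total, since it could otherwise be extended to a missing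
    \<open>u\<close>.\<close>
  have "\<exists>v. (u, v) \<in> R" for u
    using partial_endo_extend[OF R(1) alg, of u] max by metis
  then obtain \<phi> where \<phi>: "\<And>u. (u, \<phi> u) \<in> R" by metis
  have eq: "\<phi> u = v" if "(u, v) \<in> R" for u v
    using that \<phi> partial_endo_unique[OF R(1)] by blast
  show thesis
  proof (rule that; rule eq)
    show "(x, y) \<in> R" by (rule R(2))
    show "(a + b, \<phi> a + \<phi> b) \<in> R" "(a * b, \<phi> a * \<phi> b) \<in> R" for a b
      by (rule partial_endo_add[OF R(1) \<phi> \<phi>] partial_endo_mult[OF R(1) \<phi> \<phi>])+
    show "(of_rat q, of_rat q) \<in> R" for q by (rule partial_endo_rat[OF R(1)])
  qed
qed

section \<open>Conjugates of an algebraic number\<close>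

lemma rat_poly_endomorphism:
  fixes \<phi> :: "'a::field_char_0 \<Rightarrow> 'a"
  assumes "\<And>a b. \<phi> (a + b) = \<phi> a + \<phi> b" "\<And>a b. \<phi> (a * b) = \<phi> a * \<phi> b"
    "\<And>q. \<phi> (of_rat q) = of_rat q"
  shows "\<phi> (rat_poly p x) = rat_poly p (\<phi> x)"
  using assms(3)[of 0] by (induction p) (simp_all add: assms)

text \<open>Separability: with \<open>x\<close> as its only root, \<open>p\<close> would be linear,
  making \<open>x\<close> rational, or have \<open>x\<close> as a multiple root. In the latter case
  \<open>p\<close> would divide its derivative, impossible in characteristic 0.\<close>

lemma ex_other_conjugate:
  fixes x :: "'a::{alg_closed_field, field_char_0}"
  assumes p: "Factorial_Ring.irreducible p" "rat_poly p x = 0" and x: "x \<notin> \<rat>"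
  obtains y where "y \<noteq> x" "rat_poly p y = 0"
proof -
  let ?P = "map_poly of_rat p :: 'a poly"
  have p0: "p \<noteq> 0" using p(1) by auto
  obtain q where q: "?P = [:- x, 1:] * q"
    using p(2) poly_eq_0_iff_dvd by (metis dvdE)
  have q0: "q \<noteq> 0" using q p0 by (auto simp: map_poly_eq_0_iff)
  show thesis
  proof (cases "Polynomial.degree q = 0")
    case True
    then have "Polynomial.degree p = 1"
      using q q0 by (metis degree_mult_eq degree_map_poly degree_pCons_eq_if add.right_neutral
          of_rat_eq_0_iff one_neq_zero pCons_eq_0_iff One_nat_def)
    then obtain a b where "p = [:a, b:]" "b \<noteq> 0"
      by (metis degree1_coeffs)
    then have "x = - of_rat a / of_rat b" using p(2) by (simp add: field_simps eq_neg_iff_add_eq_0)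
    then show ?thesis using x by auto
  next
    case False
    then obtain y where y: "poly q y = 0" using alg_closed_imp_poly_has_root by blast
    show ?thesis
    proof (cases "y = x")
      case True
      have "pderiv ?P = map_poly of_rat (pderiv p)"
        by (intro poly_eqI) (simp add: coeff_pderiv coeff_map_poly of_rat_mult of_rat_add)
      moreover have "poly (pderiv ?P) x = 0"
        unfolding q using y True by (simp add: pderiv_mult del: mult_pCons_left)
      ultimately have "p dvd pderiv p"
        using irreducible_dvd_rat_poly[OF p, of "pderiv p"] by metis
      then have "Polynomial.degree p = 0"
        using not_dvd_pderiv by blast
      moreover have "Polynomial.degree p \<noteq> 0"
      proof
        assume "Polynomial.degree p = 0"
        then obtain c where "p = [:c:]" by (elim degree_eq_zeroE)
        then show False using p(2) p0 by simp
      qed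
      ultimately show ?thesis by simp
    next
      case False
      moreover have "rat_poly p y = 0" using q y by simp
      ultimately show ?thesis using that by blast
    qed
  qed
qed

section \<open>Galois groups over the rationals\<close>

lemma galois_over_ratsD:
  assumes "galois_over_rats M"
  shows "subfield M ambient"
    and "Factorial_Ring.irreducible p \<Longrightarrow> rat_poly p x = 0 \<Longrightarrow> x \<in> M \<Longrightarrow> rat_poly p y = 0 \<Longrightarrow> y \<in> M"
  using assms unfolding galois_over_rats_def by blast+

text \<open>Ensures that the hull defining \<open>galois_closure\<close> is itself Galois over the
  rationals.\<close>

lemma galois_over_rats_Inter:
  assumes "\<forall>M\<in>T. galois_over_rats M" shows "galois_over_rats (\<Inter>T)"
proof -
  have "subfield (\<Inter>T) ambient"
    by (rule subfield_ambientI; use assms galois_over_ratsD(1) in \<open>blast intro: subfield_intros\<close>)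
  then show ?thesis
    using assms unfolding galois_over_rats_def by blast
qed

lemma galois_closure_galois: "galois_over_rats (galois_closure L)"
  unfolding galois_closure_def by (rule hull_in) (rule galois_over_rats_Inter)

lemma carrier_galois_group:
  "\<sigma> \<in> carrier (galois_group K M) \<longleftrightarrow> \<sigma> \<in> Bij M \<and> \<sigma> 1 = 1 \<and>
     (\<forall>x\<in>M. \<forall>y\<in>M. \<sigma> (x + y) = \<sigma> x + \<sigma> y \<and> \<sigma> (x * y) = \<sigma> x * \<sigma> y) \<and> (\<forall>x\<in>K. \<sigma> x = x)"
  using Bij_imp_funcset[of \<sigma> M] by (auto simp: galois_group_def ring_hom_def)

lemma one_galois_group: "\<one>\<^bsub>galois_group K M\<^esub> = (\<lambda>x\<in>M. x)"
  by (simp add: galois_group_def BijGroup_def)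

lemma mult_galois_group:
  assumes "\<sigma> \<in> carrier (galois_group K M)" "\<tau> \<in> carrier (galois_group K M)" "x \<in> M"
  shows "(\<sigma> \<otimes>\<^bsub>galois_group K M\<^esub> \<tau>) x = \<sigma> (\<tau> x)"
  using assms by (simp add: galois_group_def BijGroup_def compose_def)

context
  fixes M :: "'a::field_char_0 set" and \<sigma>
  assumes M: "subfield M ambient" and \<sigma>: "\<sigma> \<in> carrier (galois_group \<rat> M)"
begin

lemma galois_extensional: "\<sigma> \<in> extensional M"
  using \<sigma> by (simp add: carrier_galois_group Bij_imp_extensional)

lemma galois_closed: "x \<in> M \<Longrightarrow> \<sigma> x \<in> M"
  using \<sigma> Bij_imp_funcset[of \<sigma> M] by (auto simp: carrier_galois_group)

lemma galois_add: "x \<in> M \<Longrightarrow> y \<in> M \<Longrightarrow> \<sigma> (x + y) = \<sigma> x + \<sigma> y"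
  and galois_mult: "x \<in> M \<Longrightarrow> y \<in> M \<Longrightarrow> \<sigma> (x * y) = \<sigma> x * \<sigma> y"
  and galois_Rats: "q \<in> \<rat> \<Longrightarrow> \<sigma> q = q"
  using \<sigma> by (simp_all add: carrier_galois_group)

lemma galois_sum:
  "(\<And>i. i \<in> I \<Longrightarrow> f i \<in> M) \<Longrightarrow> \<sigma> (\<Sum>i\<in>I. f i) = (\<Sum>i\<in>I. \<sigma> (f i))"
  by (induction I rule: infinite_finite_induct)
    (simp_all add: galois_Rats galois_add subfield_sum[OF M])

lemma galois_power: "x \<in> M \<Longrightarrow> \<sigma> (x ^ n) = \<sigma> x ^ n"
  by (induction n) (simp_all add: galois_Rats galois_mult subfield_power[OF M])

end

text \<open>An irrational \<open>x\<close> has a conjugate \<open>y \<noteq> x\<close>. An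
  endomorphism of the ambient field taking \<open>x\<close> to \<open>y\<close> restricts to an
  automorphism of the normal field \<open>M\<close>, and it moves \<open>x\<close>.\<close>

lemma galois_fixed_in_Rats:
  fixes M :: "'a::{alg_closed_field, field_char_0} set"
  assumes alg: "\<forall>x::'a. algebraic x" and M: "galois_over_rats M" and x: "x \<in> M"
    and fixed: "\<And>\<sigma>. \<sigma> \<in> carrier (galois_group \<rat> M) \<Longrightarrow> \<sigma> x = x"
  shows "x \<in> \<rat>"
proof (rule ccontr)
  assume "x \<notin> \<rat>"
  obtain p where p: "Factorial_Ring.irreducible p" "rat_poly p x = 0"
    using algebraic_imp_irreducible_rat_poly alg by metis
  obtain y where y: "y \<noteq> x" "rat_poly p y = 0"
    using ex_other_conjugate[OF p \<open>x \<notin> \<rat>\<close>] .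
  obtain \<phi> where \<phi>: "\<phi> x = y" "\<And>a b. \<phi> (a + b) = \<phi> a + \<phi> b"
    "\<And>a b. \<phi> (a * b) = \<phi> a * \<phi> b" "\<And>q. \<phi> (of_rat q) = of_rat q"
    using conjugate_endomorphism[OF alg p y(2)] by blast
  have \<phi>_zero: "\<phi> 0 = 0" and \<phi>_one: "\<phi> 1 = 1"
    using \<phi>(4)[of 0] \<phi>(4)[of 1] by simp_all
  have "inj \<phi>"
  proof (rule injI, rule ccontr)
    fix a b assume ab: "\<phi> a = \<phi> b" "a \<noteq> b"
    have "\<phi> (a - b) = 0" using \<phi>(2)[of "a - b" b] ab by simp
    then have "\<phi> ((a - b) * inverse (a - b)) = 0" by (simp add: \<phi>(3))
    then show False using ab(2) \<phi>_one by simp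
  qed
  have root: "rat_poly q (\<phi> z) = 0" if "rat_poly q z = 0" for q z
    using rat_poly_endomorphism[of \<phi> q z] \<phi> \<phi>_zero that by simp
  have closed: "\<phi> z \<in> M" if z: "z \<in> M" for z
  proof -
    obtain q where "Factorial_Ring.irreducible q" "rat_poly q z = 0"
      using algebraic_imp_irreducible_rat_poly alg by metis
    then show ?thesis using galois_over_ratsD(2)[OF M] root z by blast
  qed
  \<comment> \<open>The injective \<open>\<phi>\<close> permutes the finite root set of each
    \<open>q\<close>, which lies in \<open>M\<close> by normality.\<close>
  have "M \<subseteq> \<phi> ` M"
  proof
    fix z assume z: "z \<in> M"
    obtain q where q: "Factorial_Ring.irreducible q" "rat_poly q z = 0"
      using algebraic_imp_irreducible_rat_poly alg by metis
    define Z where "Z = {w :: 'a. rat_poly q w = 0}"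
    have "q \<noteq> 0" using q(1) by auto
    then have "finite Z"
      unfolding Z_def by (intro poly_roots_finite) (simp add: map_poly_eq_0_iff)
    moreover have "\<phi> ` Z \<subseteq> Z" unfolding Z_def using root by auto
    ultimately have "\<phi> ` Z = Z"
      using \<open>inj \<phi>\<close> by (meson endo_inj_surj inj_on_subset subset_UNIV)
    moreover have "z \<in> Z" using q(2) by (simp add: Z_def)
    moreover have "Z \<subseteq> M" unfolding Z_def using galois_over_ratsD(2)[OF M q z] by auto
    ultimately show "z \<in> \<phi> ` M" by blast
  qed
  then have "bij_betw \<phi> M M"
    using closed \<open>inj \<phi>\<close> by (auto simp: bij_betw_def intro: inj_on_subset)
  then have "restrict \<phi> M \<in> Bij M"
    by (auto simp: Bij_def cong: bij_betw_cong)
  moreover note MF = galois_over_ratsD(1)[OF M]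
  moreover have "\<phi> q = q" if "q \<in> \<rat>" for q using that \<phi>(4) by (auto elim: Rats_cases)
  ultimately have "restrict \<phi> M \<in> carrier (galois_group \<rat> M)"
    using subfield_Rats[OF MF] subfield_one[OF MF]
    by (auto simp: carrier_galois_group \<phi> \<phi>_one subfield_intros[OF MF])
  from fixed[OF this] show False using x \<phi>(1) y(1) by simp
qed

text \<open>Artin's induction: choose \<open>w\<close> separating \<open>\<sigma>\<close> from
  \<open>\<tau>\<close>; the relation at \<open>w * z\<close> minus \<open>\<tau> w\<close> times
  the relation at \<open>z\<close> has no \<open>\<tau>\<close> term left.\<close>

lemma independence_of_characters:
  fixes S :: "('a::monoid_mult \<Rightarrow> 'b::field) set"
  assumes "finite S" "S \<subseteq> extensional M" "1 \<in> M" "\<And>x y. x \<in> M \<Longrightarrow> y \<in> M \<Longrightarrow> x * y \<in> M"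
    and "\<And>\<sigma>. \<sigma> \<in> S \<Longrightarrow> \<sigma> 1 = 1"
    and "\<And>\<sigma> x y. \<sigma> \<in> S \<Longrightarrow> x \<in> M \<Longrightarrow> y \<in> M \<Longrightarrow> \<sigma> (x * y) = \<sigma> x * \<sigma> y"
    and "\<And>z. z \<in> M \<Longrightarrow> (\<Sum>\<sigma>\<in>S. c \<sigma> * \<sigma> z) = 0"
  shows "\<forall>\<sigma>\<in>S. c \<sigma> = 0"
  using assms
proof (induction S arbitrary: c rule: finite_induct)
  case (insert \<tau> S)
  have "c \<sigma> = 0" if \<sigma>: "\<sigma> \<in> S" for \<sigma>
  proof -
    have "\<sigma> \<noteq> \<tau>" using \<sigma> insert.hyps by auto
    \<comment> \<open>Extensional maps that agree on \<open>M\<close> are equal, so distinct ones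
      differ at some \<open>w\<close> in \<open>M\<close>.\<close>
    moreover have "\<sigma> \<in> extensional M" "\<tau> \<in> extensional M" using insert.prems(1) \<sigma> by auto
    ultimately obtain w where w: "w \<in> M" "\<sigma> w \<noteq> \<tau> w"
      by (meson extensionalityI)
    have "\<forall>\<rho>\<in>S. c \<rho> * (\<rho> w - \<tau> w) = 0"
    proof (rule insert.IH)
      fix z assume z: "z \<in> M"
      have "0 = (\<Sum>\<rho>\<in>insert \<tau> S. c \<rho> * \<rho> (w * z)) - \<tau> w * (\<Sum>\<rho>\<in>insert \<tau> S. c \<rho> * \<rho> z)"
        using insert.prems(6) z insert.prems(3)[OF w(1) z] by simp
      also have "\<dots> = (\<Sum>\<rho>\<in>insert \<tau> S. c \<rho> * (\<rho> w - \<tau> w) * \<rho> z)"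
        unfolding sum_distrib_left sum_subtractf[symmetric]
        using insert.prems(5) w(1) z by (intro sum.cong) (auto simp: algebra_simps)
      also have "\<dots> = (\<Sum>\<rho>\<in>S. c \<rho> * (\<rho> w - \<tau> w) * \<rho> z)"
        using insert.hyps by simp
      finally show "(\<Sum>\<rho>\<in>S. c \<rho> * (\<rho> w - \<tau> w) * \<rho> z) = 0" by simp
    qed (use insert.prems in auto)
    then show ?thesis using \<sigma> w(2) by auto
  qed
  \<comment> \<open>Only the \<open>\<tau>\<close> term of the relation survives; it is evaluated at
    1.\<close>
  moreover from this have "c \<tau> = 0"
    using insert.prems(6)[OF insert.prems(2)] insert.prems(4)[of \<tau>] insert.hyps by simp
  ultimately show ?case by auto
qed simp

section \<open>Traces, orbit sums and descent to a subfield\<close>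

context
  fixes M :: "'a::{alg_closed_field, field_char_0} set" and G
  defines "G \<equiv> galois_group \<rat> M"
  assumes alg: "\<forall>x::'a. algebraic x" and M: "galois_over_rats M"
    and grp: "group G" and fin: "finite (carrier G)"
begin

interpretation group G by (rule grp)

lemmas M_subfield = galois_over_ratsD(1)[OF M]

text \<open>Left multiplication by \<open>\<sigma>\<close> permutes the group, so every automorphism
  fixes the trace.\<close>

lemma galois_trace_in_Rats:
  assumes z: "z \<in> M"
  shows "(\<Sum>\<tau>\<in>carrier G. \<tau> z) \<in> \<rat>"
proof (rule galois_fixed_in_Rats[OF alg M])
  show "(\<Sum>\<tau>\<in>carrier G. \<tau> z) \<in> M"
    using galois_closed[OF M_subfield] z by (intro subfield_sum[OF M_subfield]) (auto simp: G_def)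
  fix \<sigma> assume "\<sigma> \<in> carrier (galois_group \<rat> M)"
  then have \<sigma>: "\<sigma> \<in> carrier G" by (simp add: G_def)
  have "\<sigma> (\<Sum>\<tau>\<in>carrier G. \<tau> z) = (\<Sum>\<tau>\<in>carrier G. \<sigma> (\<tau> z))"
    using \<sigma> galois_closed[OF M_subfield] z by (intro galois_sum[OF M_subfield]) (auto simp: G_def)
  also have "\<dots> = (\<Sum>\<tau>\<in>carrier G. (\<sigma> \<otimes>\<^bsub>G\<^esub> \<tau>) z)"
    using \<sigma> z by (intro sum.cong) (auto simp: G_def mult_galois_group)
  also have "\<dots> = (\<Sum>\<tau>\<in>carrier G. \<tau> z)"
    using \<sigma> inj_on_cmult[OF \<sigma>] surj_const_mult[OF \<sigma>]
    by (intro sum.reindex_bij_betw) (auto simp: bij_betw_def)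
  finally show "\<sigma> (\<Sum>\<tau>\<in>carrier G. \<tau> z) = (\<Sum>\<tau>\<in>carrier G. \<tau> z)" .
qed

text \<open>The orbit sums over the three sets of all \<open>\<tau>\<close> with \<open>\<pi> \<tau> j = k\<close> are permuted by the Galois
  group in the same way as the points \<open>k\<close>, so they are the roots of a rational cubic.\<close>

lemma ex_moved_rat_cubic_root:
  fixes \<pi> :: "('a \<Rightarrow> 'a) \<Rightarrow> nat \<Rightarrow> nat"
  assumes perm: "\<And>\<tau>. \<tau> \<in> carrier G \<Longrightarrow> \<pi> \<tau> permutes {1..3}"
    and hom: "\<And>\<sigma> \<tau>. \<sigma> \<in> carrier G \<Longrightarrow> \<tau> \<in> carrier G \<Longrightarrow> \<pi> (\<sigma> \<otimes>\<^bsub>G\<^esub> \<tau>) = \<pi> \<sigma> \<circ> \<pi> \<tau>"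
    and \<sigma>: "\<sigma> \<in> carrier G" and j: "\<pi> \<sigma> j \<noteq> j"
  obtains y where "y \<in> M" "\<sigma> y \<noteq> y" "rat_cubic_root y" "rat_cubic_root (\<sigma> y)"
proof -
  define Y where "Y k z = (\<Sum>\<tau> | \<tau> \<in> carrier G \<and> \<pi> \<tau> j = k. \<tau> z)" for k z
  have Y_closed: "Y k z \<in> M" if "z \<in> M" for k z
    unfolding Y_def using galois_closed[OF M_subfield] that
    by (intro subfield_sum[OF M_subfield]) (auto simp: G_def)
  have Y_act: "\<rho> (Y k z) = Y (\<pi> \<rho> k) z" if \<rho>: "\<rho> \<in> carrier G" and z: "z \<in> M" for \<rho> k z
  proof -
    have "bij_betw (\<lambda>\<tau>. \<rho> \<otimes>\<^bsub>G\<^esub> \<tau>) {\<tau> \<in> carrier G. \<pi> \<tau> j = k} {\<tau> \<in> carrier G. \<pi> \<tau> j = \<pi> \<rho> k}"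
      unfolding bij_betw_def
    proof
      show "inj_on (\<lambda>\<tau>. \<rho> \<otimes>\<^bsub>G\<^esub> \<tau>) {\<tau> \<in> carrier G. \<pi> \<tau> j = k}"
        using inj_on_cmult[OF \<rho>] by (rule inj_on_subset) auto
      show "(\<lambda>\<tau>. \<rho> \<otimes>\<^bsub>G\<^esub> \<tau>) ` {\<tau> \<in> carrier G. \<pi> \<tau> j = k} = {\<tau> \<in> carrier G. \<pi> \<tau> j = \<pi> \<rho> k}"
      proof (intro subset_antisym subsetI)
        fix \<tau> assume "\<tau> \<in> {\<tau> \<in> carrier G. \<pi> \<tau> j = \<pi> \<rho> k}"
        then have \<tau>: "\<tau> \<in> carrier G" "\<pi> \<tau> j = \<pi> \<rho> k" by auto
        then obtain \<tau>' where \<tau>': "\<tau>' \<in> carrier G" "\<tau> = \<rho> \<otimes>\<^bsub>G\<^esub> \<tau>'"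
          using surj_const_mult[OF \<rho>] by blast
        then have "\<pi> \<rho> (\<pi> \<tau>' j) = \<pi> \<rho> k" using hom[OF \<rho> \<tau>'(1)] \<tau>(2) by simp
        then have "\<pi> \<tau>' j = k" using permutes_inj[OF perm[OF \<rho>]] by (simp add: inj_eq)
        then show "\<tau> \<in> (\<lambda>\<tau>. \<rho> \<otimes>\<^bsub>G\<^esub> \<tau>) ` {\<tau> \<in> carrier G. \<pi> \<tau> j = k}" using \<tau>' by blast
      qed (use \<rho> hom in auto)
    qed
    then have "Y (\<pi> \<rho> k) z = (\<Sum>\<tau> | \<tau> \<in> carrier G \<and> \<pi> \<tau> j = k. (\<rho> \<otimes>\<^bsub>G\<^esub> \<tau>) z)"
      unfolding Y_def by (intro sum.reindex_bij_betw[symmetric]) auto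
    also have "\<dots> = (\<Sum>\<tau> | \<tau> \<in> carrier G \<and> \<pi> \<tau> j = k. \<rho> (\<tau> z))"
      using \<rho> z by (intro sum.cong) (auto simp: G_def mult_galois_group)
    also have "\<dots> = \<rho> (Y k z)"
      unfolding Y_def using \<rho> galois_closed[OF M_subfield] z
      by (intro galois_sum[OF M_subfield, symmetric]) (auto simp: G_def)
    finally show ?thesis by simp
  qed
  have cubic: "rat_cubic_root (Y k z)" if z: "z \<in> M" and k: "k \<in> {1..3}" for k z
  proof -
    \<comment> \<open>The power sums of the three orbit sums are Galois invariant, hence rational.
      Newton's identities turn them into the coefficients \<open>a\<close>, \<open>b\<close>,
      \<open>c\<close> of the cubic.\<close>
    define p where "p r = (\<Sum>k\<in>{1..3::nat}. Y k z ^ r)" for r :: nat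
    have p: "p r \<in> \<rat>" for r
    proof (rule galois_fixed_in_Rats[OF alg M])
      show "p r \<in> M" unfolding p_def using Y_closed z by (intro subfield_intros[OF M_subfield])
      fix \<rho> assume "\<rho> \<in> carrier (galois_group \<rat> M)"
      then have \<rho>: "\<rho> \<in> carrier G" by (simp add: G_def)
      have "\<rho> (p r) = (\<Sum>k\<in>{1..3::nat}. \<rho> (Y k z ^ r))"
        unfolding p_def using \<rho> Y_closed[OF z]
        by (intro galois_sum[OF M_subfield]) (auto simp: G_def intro: subfield_power[OF M_subfield])
      also have "\<dots> = (\<Sum>k\<in>{1..3::nat}. Y (\<pi> \<rho> k) z ^ r)"
        using \<rho> Y_act[OF \<rho> z] Y_closed[OF z] galois_power[OF M_subfield, of \<rho>]
        by (simp add: G_def)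
      also have "\<dots> = p r"
        unfolding p_def using sum.permute[OF perm[OF \<rho>], of "\<lambda>k. Y k z ^ r"] by (simp add: o_def)
      finally show "\<rho> (p r) = p r" .
    qed
    have expand: "p r = Y 1 z ^ r + Y 2 z ^ r + Y 3 z ^ r" for r
      unfolding p_def by (simp add: numeral_3_eq_3 numeral_2_eq_2 algebra_simps)
    define a where "a = - p 1"
    define b where "b = (p 1 ^ 2 - p 2) / 2"
    define c where "c = - (p 1 ^ 3 - 3 * p 1 * p 2 + 2 * p 3) / 6"
    have a: "a = - (Y 1 z + Y 2 z + Y 3 z)" unfolding a_def expand by simp
    have b: "b = Y 1 z * Y 2 z + Y 2 z * Y 3 z + Y 1 z * Y 3 z"
      unfolding b_def expand by (simp add: field_simps power2_eq_square)
    have c: "c = - (Y 1 z * Y 2 z * Y 3 z)"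
      unfolding c_def expand by (simp add: field_simps power2_eq_square power3_eq_cube)
    have "t ^ 3 + a * t ^ 2 + b * t + c = (t - Y 1 z) * (t - Y 2 z) * (t - Y 3 z)" for t
      unfolding a b c by (simp add: algebra_simps power2_eq_square power3_eq_cube)
    moreover have "k = 1 \<or> k = 2 \<or> k = 3" using k by auto
    ultimately have "Y k z ^ 3 + a * Y k z ^ 2 + b * Y k z + c = 0" by auto
    moreover have "a \<in> \<rat>" "b \<in> \<rat>" "c \<in> \<rat>" unfolding a_def b_def c_def using p by auto
    ultimately show ?thesis unfolding rat_cubic_root_def by blast
  qed
  have j3: "j \<in> {1..3}" using perm[OF \<sigma>] j by (meson permutes_not_in)
  have "\<exists>z\<in>M. Y (\<pi> \<sigma> j) z \<noteq> Y j z"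
  proof (rule ccontr)
    assume eq: "\<not> ?thesis"
    \<comment> \<open>If \<open>Y (\<pi> \<sigma> j)\<close> and \<open>Y j\<close> agreed on
      \<open>M\<close>, these coefficients would give a linear relation between the automorphisms,
      although \<open>c \<sigma> = 1\<close>.\<close>
    define c :: "('a \<Rightarrow> 'a) \<Rightarrow> 'a" where "c \<tau> = of_bool (\<pi> \<tau> j = \<pi> \<sigma> j) - of_bool (\<pi> \<tau> j = j)" for \<tau>
    have "\<forall>\<tau>\<in>carrier G. c \<tau> = 0"
    proof (rule independence_of_characters[where M = M])
      fix z assume z: "z \<in> M"
      have "(\<Sum>\<tau>\<in>carrier G. c \<tau> * \<tau> z) = Y (\<pi> \<sigma> j) z - Y j z"
        unfolding c_def Y_def left_diff_distrib sum_subtractf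
        by (auto simp: fin of_bool_def if_distrib[of "\<lambda>x. x * _"] sum.If_cases Int_def cong: if_cong)
      then show "(\<Sum>\<tau>\<in>carrier G. c \<tau> * \<tau> z) = 0" using eq z by simp
    qed (use fin M_subfield in \<open>auto simp: G_def galois_extensional galois_mult galois_Rats
        intro: subfield_intros\<close>)
    then have "c \<sigma> = 0" using \<sigma> by blast
    then show False using j by (simp add: c_def)
  qed
  then obtain z where z: "z \<in> M" "Y (\<pi> \<sigma> j) z \<noteq> Y j z" by blast
  show thesis
  proof (rule that)
    show "Y j z \<in> M" "\<sigma> (Y j z) \<noteq> Y j z" "rat_cubic_root (Y j z)" "rat_cubic_root (\<sigma> (Y j z))"
      using z Y_closed Y_act[OF \<sigma> z(1)] cubic j3 permutes_in_image[OF perm[OF \<sigma>]] by auto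
  qed
qed

text \<open>Weights that vanish at every automorphism except the identity isolate \<open>x\<close>:
  the weighted trace is a nonzero element of \<open>C\<close> times \<open>x\<close>, and it lies in
  \<open>C\<close> itself.\<close>

lemma subset_subfield_if_moved:
  assumes C: "subfield C ambient"
    and moved: "\<And>\<sigma>. \<sigma> \<in> carrier G \<Longrightarrow> \<sigma> \<noteq> \<one>\<^bsub>G\<^esub> \<Longrightarrow> \<exists>y\<in>M. \<sigma> y \<noteq> y \<and> y \<in> C \<and> \<sigma> y \<in> C"
  shows "M \<subseteq> C"
proof
  fix x assume x: "x \<in> M"
  obtain y where y: "\<And>\<sigma>. \<sigma> \<in> carrier G - {\<one>\<^bsub>G\<^esub>} \<Longrightarrow>
      y \<sigma> \<in> M \<and> \<sigma> (y \<sigma>) \<noteq> y \<sigma> \<and> y \<sigma> \<in> C \<and> \<sigma> (y \<sigma>) \<in> C"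
    using moved by (metis DiffE insertI1)
  \<comment> \<open>The weight is defined over an arbitrary set \<open>S\<close>, so that its
    factors can be added one at a time.\<close>
  define P where "P S \<tau> = (\<Prod>\<sigma>\<in>S. \<tau> (y \<sigma>) - \<sigma> (y \<sigma>))" for S \<tau>
  have sum_in_C: "(\<Sum>\<tau>\<in>carrier G. P S \<tau> * \<tau> z) \<in> C"
    if "finite S" "S \<subseteq> carrier G - {\<one>\<^bsub>G\<^esub>}" "z \<in> M" for S z
    using that
  proof (induction S arbitrary: z rule: finite_induct)
    case empty
    then show ?case
      using galois_trace_in_Rats[of z] subfield_Rats[OF C] by (auto simp: P_def)
  next
    case (insert s S)
    have s: "y s \<in> M" "s (y s) \<in> C" using y insert.prems by auto
    \<comment> \<open>The new factor \<open>\<tau> (y s) - s (y s)\<close> splits the sum: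
      \<open>\<tau> (y s)\<close> is absorbed by passing from \<open>z\<close> to
      \<open>y s * z\<close>, which the induction allows, and \<open>s (y s)\<close> is a constant
      from \<open>C\<close>.\<close>
    have "(\<Sum>\<tau>\<in>carrier G. P (insert s S) \<tau> * \<tau> z) =
        (\<Sum>\<tau>\<in>carrier G. P S \<tau> * \<tau> (y s * z)) - s (y s) * (\<Sum>\<tau>\<in>carrier G. P S \<tau> * \<tau> z)"
      unfolding sum_distrib_left sum_subtractf[symmetric]
    proof (intro sum.cong refl)
      fix \<tau> assume "\<tau> \<in> carrier G"
      then have "\<tau> (y s * z) = \<tau> (y s) * \<tau> z"
        using galois_mult[OF M_subfield] s insert.prems by (simp add: G_def)
      then show "P (insert s S) \<tau> * \<tau> z = P S \<tau> * \<tau> (y s * z) - s (y s) * (P S \<tau> * \<tau> z)"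
        using insert.hyps by (simp add: P_def algebra_simps)
    qed
    moreover have "y s * z \<in> M" using s insert.prems subfield_mult[OF M_subfield] by simp
    ultimately show ?case
      using insert s by (auto intro!: subfield_diff[OF C] subfield_mult[OF C])
  qed
  let ?S = "carrier G - {\<one>\<^bsub>G\<^esub>}"
  \<comment> \<open>The factor with \<open>\<sigma> = \<tau>\<close> vanishes.\<close>
  have "P ?S \<tau> = 0" if "\<tau> \<in> ?S" for \<tau>
    unfolding P_def using fin that by (intro prod_zero) auto
  then have "(\<Sum>\<tau>\<in>carrier G. P ?S \<tau> * \<tau> x) = P ?S \<one>\<^bsub>G\<^esub> * \<one>\<^bsub>G\<^esub> x"
    using fin one_closed by (subst sum.remove[of _ "\<one>\<^bsub>G\<^esub>"]) auto
  also have "\<one>\<^bsub>G\<^esub> x = x" using x by (simp add: G_def one_galois_group)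
  finally have "P ?S \<one>\<^bsub>G\<^esub> * x \<in> C" using sum_in_C[of ?S x] fin x by simp
  moreover have eq: "P ?S \<one>\<^bsub>G\<^esub> = (\<Prod>\<sigma>\<in>?S. y \<sigma> - \<sigma> (y \<sigma>))"
    unfolding P_def using y by (intro prod.cong) (auto simp: G_def one_galois_group)
  have "P ?S \<one>\<^bsub>G\<^esub> \<in> C" unfolding eq using y by (intro subfield_intros[OF C]) auto
  moreover have "P ?S \<one>\<^bsub>G\<^esub> \<noteq> 0"
  proof
    assume "P ?S \<one>\<^bsub>G\<^esub> = 0"
    then obtain \<sigma> where "\<sigma> \<in> ?S" "y \<sigma> - \<sigma> (y \<sigma>) = 0"
      unfolding eq using fin by (auto simp: prod_zero_iff simp del: right_minus_eq)
    then show False using y[of \<sigma>] by simp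
  qed
  ultimately show "x \<in> C"
    using subfield_divide[OF C, of "P ?S \<one>\<^bsub>G\<^esub> * x" "P ?S \<one>\<^bsub>G\<^esub>"] by simp
qed

end

section \<open>Groups of generalized $S_3$-type\<close>

text \<open>\<open>\<pi>\<close> is a coordinate of the embedding \<open>f\<close> into a power of
  S_3; as \<open>f\<close> is injective, some coordinate distinguishes \<open>\<sigma>\<close> from
  the identity.\<close>

lemma generalized_S3_type_separating:
  assumes "generalized_S3_type G" "\<sigma> \<in> carrier G" "\<sigma> \<noteq> \<one>\<^bsub>G\<^esub>"
  obtains \<pi> :: "_ \<Rightarrow> nat \<Rightarrow> nat" and j where
    "\<And>\<tau>. \<tau> \<in> carrier G \<Longrightarrow> \<pi> \<tau> permutes {1..3}"
    "\<And>\<rho> \<tau>. \<rho> \<in> carrier G \<Longrightarrow> \<tau> \<in> carrier G \<Longrightarrow> \<pi> (\<rho> \<otimes>\<^bsub>G\<^esub> \<tau>) = \<pi> \<rho> \<circ> \<pi> \<tau>"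
    "\<pi> \<sigma> j \<noteq> j"
proof -
  obtain n :: nat and H where grp: "group G"
    and H: "subgroup H (product_group {..<n} (\<lambda>_. sym_group 3))"
    and iso: "G \<cong> (product_group {..<n} (\<lambda>_. sym_group 3))\<lparr>carrier := H\<rparr>"
    using assms(1) unfolding generalized_S3_type_def Let_def by blast
  interpret group G by (rule grp)
  obtain f where f: "f \<in> iso G ((product_group {..<n} (\<lambda>_. sym_group 3))\<lparr>carrier := H\<rparr>)"
    using iso unfolding is_iso_def by blast
  have inj: "inj_on f (carrier G)"
    and f_H: "f \<tau> \<in> H" if "\<tau> \<in> carrier G" for \<tau>
    using f that by (auto simp: iso_def bij_betw_def)
  have f_carrier: "f \<tau> \<in> (\<Pi>\<^sub>E i\<in>{..<n}. carrier (sym_group 3))" if "\<tau> \<in> carrier G" for \<tau>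
    using f_H[OF that] subgroup.subset[OF H] by auto
  have mult: "f (\<rho> \<otimes>\<^bsub>G\<^esub> \<tau>) i = f \<rho> i \<circ> f \<tau> i"
    if "\<rho> \<in> carrier G" "\<tau> \<in> carrier G" "i < n" for \<rho> \<tau> i
    using f that by (auto simp: iso_def hom_def sym_group_mult)
  have perm: "f \<tau> i permutes {1..3}" if "\<tau> \<in> carrier G" "i < n" for \<tau> i
    using PiE_mem[OF f_carrier[OF that(1)], of i] that(2) by (simp add: sym_group_carrier)
  have one: "f \<one>\<^bsub>G\<^esub> i = id" if "i < n" for i
  proof -
    \<comment> \<open>An idempotent injective map is the identity.\<close>
    have "f \<one>\<^bsub>G\<^esub> i \<circ> f \<one>\<^bsub>G\<^esub> i = f \<one>\<^bsub>G\<^esub> i \<circ> id"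
      using mult[of "\<one>\<^bsub>G\<^esub>" "\<one>\<^bsub>G\<^esub>" i] that by simp
    then show ?thesis
      using permutes_inj[OF perm[OF one_closed that]] by (simp add: fun_eq_iff inj_eq)
  qed
  have "f \<sigma> \<noteq> f \<one>\<^bsub>G\<^esub>" using inj assms(2,3) by (auto dest: inj_onD)
  then obtain i where i: "i < n" "f \<sigma> i \<noteq> f \<one>\<^bsub>G\<^esub> i"
    using f_carrier[OF assms(2)] f_carrier[OF one_closed] by (metis PiE_ext lessThan_iff)
  then obtain j where "f \<sigma> i j \<noteq> j" using one by (auto simp: fun_eq_iff)
  then show thesis using that[of "\<lambda>\<tau>. f \<tau> i" j] perm mult i(1) by blast
qed

theorem theorem3p6:
  fixes L :: "'a::{alg_closed_field, field_char_0} set"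
  assumes "\<forall>x::'a. algebraic x"
    and "number_field L"
    and "generalized_S3_type (galois_group \<rat> (galois_closure L))"
  shows "L \<subseteq> galois_closure L \<and> galois_closure L \<subseteq> compositum_of_cubic_fields"
proof
  show "L \<subseteq> galois_closure L"
    unfolding galois_closure_def by (rule hull_subset)
  let ?M = "galois_closure L"
  let ?G = "galois_group \<rat> ?M"
  have grp: "group ?G" and fin: "finite (carrier ?G)"
    using assms(3) by (auto simp: generalized_S3_type_def)
  show "?M \<subseteq> compositum_of_cubic_fields"
  \<comment> \<open>The descent is applied to the compositum: the orbit sum moved by
    \<open>\<sigma>\<close> and its image are both roots of rational cubics.\<close>
  proof (rule subset_subfield_if_moved[OF assms(1) galois_closure_galois grp fin subfield_compositum])
    fix \<sigma> assume \<sigma>: "\<sigma> \<in> carrier ?G" "\<sigma> \<noteq> \<one>\<^bsub>?G\<^esub>"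
    obtain \<pi> :: "('a \<Rightarrow> 'a) \<Rightarrow> nat \<Rightarrow> nat" and j where
      \<pi>: "\<And>\<tau>. \<tau> \<in> carrier ?G \<Longrightarrow> \<pi> \<tau> permutes {1..3}"
      "\<And>\<rho> \<tau>. \<rho> \<in> carrier ?G \<Longrightarrow> \<tau> \<in> carrier ?G \<Longrightarrow> \<pi> (\<rho> \<otimes>\<^bsub>?G\<^esub> \<tau>) = \<pi> \<rho> \<circ> \<pi> \<tau>"
      "\<pi> \<sigma> j \<noteq> j"
      by (rule generalized_S3_type_separating[OF assms(3) \<sigma>]) (rule that)
    obtain y where "y \<in> ?M" "\<sigma> y \<noteq> y" "rat_cubic_root y" "rat_cubic_root (\<sigma> y)"
      by (rule ex_moved_rat_cubic_root[where \<pi> = \<pi> and j = j,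
            OF assms(1) galois_closure_galois grp fin _ _ \<sigma>(1) \<pi>(3)])
        (rule \<pi>(1) \<pi>(2) that; assumption)+
    then show "\<exists>y\<in>?M. \<sigma> y \<noteq> y \<and> y \<in> compositum_of_cubic_fields \<and> \<sigma> y \<in> compositum_of_cubic_fields"
      using rat_cubic_root_in_compositum by blast
  qed
qed

end
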